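(* Let $(H,\langle\cdot,\cdot\rangle)$ be an inner product space over $\mathbb{K}$ ($\mathbb{K}=\mathbb{R}$ or $\mathbb{C}$), let $\{e_i\}_{i\in I}$ be a family of orthonormal vectors in $H$, $F$ a finite subset of $I$, and $\phi_i,\Phi_i\in\mathbb{K}$ for $i\in I$. For $x\in H$, the following two conditions are equivalent: (i) $\operatorname{Re}\left\langle \sum_{i\in F}\Phi_i e_i-x,\ x-\sum_{i\in F}\phi_i e_i\right\rangle\ge 0$; (ii) $\left\| x-\sum_{i\in F}\frac{\phi_i+\Phi_i}{2}e_i\right\|\le \frac12\left(\sum_{i\in F}|\Phi_i-\phi_i|^2\right)^{1/2}$. If either of them holds, then $$0\le \|x\|^2-\sum_{i\in F}|\langle x,e_i\rangle|^2\le \frac14\sum_{i\in F}|\Phi_i-\phi_i|^2-\sum_{i\in F}\left|\frac{\phi_i+\Phi_i}{2}-\langle x,e_i\rangle\right|^2\le \frac14\sum_{i\in F}|\Phi_i-\phi_i|^2 .$$ The constant $\frac14$ is best possible in both inequalities: for every real $c<\frac14$, neither the bound $\|x\|^2-\sum_{i\in F}|\langle x,e_i\rangle|^2\le c\sum_{i\in F}|\Phi_i-\phi_i|^2-\sum_{i\in F}\left|\frac{\phi_i+\Phi_i}{2}-\langle x,e_i\rangle\right|^2$ nor the bound $\|x\|^2-\sum_{i\in F}|\langle x,e_i\rangle|^2\le c\sum_{i\in F}|\Phi_i-\phi_i|^2$ holds for all choices of an inner product space $H$ over $\mathbb{K}$, a family $\{e_i\}_{i\in I}$ of orthonormal vectors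 in $H$, a finite subset $F$ of $I$, scalars $\phi_i,\Phi_i\in\mathbb{K}$ and a vector $x\in H$ satisfying $\operatorname{Re}\left\langle \sum_{i\in F}\Phi_i e_i-x,\ x-\sum_{i\in F}\phi_i e_i\right\rangle\ge 0$.
   Context: The inner product is linear in the first argument and conjugate-linear in the second; $\|x\|=\langle x,x\rangle^{1/2}$. $H$ is not assumed complete. *)

theory Defs
  imports "HOL-Analysis.Inner_Product" "HOL-Analysis.Product_Vector"
begin

text \<open>
  The scalar fields \<open>\<real>\<close> and \<open>\<complex>\<close>, treated uniformly: a type in this class comes with a
  norm-preserving homomorphism of real algebras into \<open>complex\<close> (hence injective) whose image is
  the real line or all of \<open>complex\<close>. So its members are, up to isomorphism, exactly
  \<open>real\<close> and \<open>complex\<close>.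
\<close>

class real_or_complex = real_normed_field +
  fixes to_complex :: "'a \<Rightarrow> complex"
  assumes to_complex_add: "to_complex (x + y) = to_complex x + to_complex y"
    and to_complex_mult: "to_complex (x * y) = to_complex x * to_complex y"
    and to_complex_one: "to_complex 1 = 1"
    and to_complex_scaleR: "to_complex (r *\<^sub>R x) = r *\<^sub>R to_complex x"
    and norm_to_complex: "norm (to_complex x) = norm x"
    and range_to_complex: "range to_complex = \<real> \<or> range to_complex = UNIV"

instantiation real :: real_or_complex
begin
definition to_complex_real :: "real \<Rightarrow> complex" where "to_complex_real = complex_of_real"
instance by standard (auto simp: to_complex_real_def Reals_def scaleR_conv_of_real)
end

instantiation complex :: real_or_complex
begin
definition to_complex_complex :: "complex \<Rightarrow> complex" where "to_complex_complex = (\<lambda>z. z)"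
instance by standard (auto simp: to_complex_complex_def)
end

definition re_part :: "'k::real_or_complex \<Rightarrow> real" where
  "re_part z = Re (to_complex z)"

definition scalar_cnj :: "'k::real_or_complex \<Rightarrow> 'k" where
  "scalar_cnj z = inv to_complex (cnj (to_complex z))"

lemma inj_to_complex: "inj (to_complex :: 'k::real_or_complex \<Rightarrow> complex)"
proof (rule injI)
  fix x y :: 'k
  assume "to_complex x = to_complex y"
  moreover have "to_complex (x - y) + to_complex y = to_complex x"
    by (metis to_complex_add diff_add_cancel)
  ultimately have "norm (to_complex (x - y)) = 0" by simp
  then show "x = y" by (simp add: norm_to_complex)
qed

lemma to_complex_scalar_cnj: "to_complex (scalar_cnj z) = cnj (to_complex z)"
proof -
  have "cnj (to_complex z) \<in> range (to_complex :: 'a \<Rightarrow> complex)"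
    using range_to_complex[where ?'a = 'a] Reals_cnj_iff by (metis UNIV_I rangeI)
  then show ?thesis unfolding scalar_cnj_def by (rule f_inv_into_f)
qed

lemma re_part_real [simp]: "re_part (x::real) = x"
  by (simp add: re_part_def to_complex_real_def)

lemma re_part_complex [simp]: "re_part (z::complex) = Re z"
  by (simp add: re_part_def to_complex_complex_def)

lemma scalar_cnj_real [simp]: "scalar_cnj (x::real) = x"
  using to_complex_scalar_cnj[of x] by (simp add: to_complex_real_def)

lemma scalar_cnj_complex [simp]: "scalar_cnj (z::complex) = cnj z"
  using to_complex_scalar_cnj[of z] by (simp add: to_complex_complex_def)

locale inner_product_space = vector_space scale
  for scale :: "'k::real_or_complex \<Rightarrow> 'h::ab_group_add \<Rightarrow> 'h" +
  fixes ip :: "'h \<Rightarrow> 'h \<Rightarrow> 'k"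
  assumes ip_add_left: "ip (x + y) z = ip x z + ip y z"
    and ip_scale_left: "ip (scale a x) y = a * ip x y"
    and ip_commute: "ip y x = scalar_cnj (ip x y)"
    and ip_nonneg: "0 \<le> re_part (ip x x)"
    and ip_eq_zero: "ip x x = 0 \<Longrightarrow> x = 0"

lemma inner_product_space_real_inner:
  "inner_product_space (scaleR :: real \<Rightarrow> 'h::real_inner \<Rightarrow> 'h) inner"
  by unfold_locales
    (auto simp: inner_add_left inner_commute algebra_simps)

lemma inner_product_space_complex:
  "inner_product_space (*) (\<lambda>z w :: complex. z * cnj w)"
  by unfold_locales (auto simp: algebra_simps)

definition ip_norm :: "('h \<Rightarrow> 'h \<Rightarrow> 'k::real_or_complex) \<Rightarrow> 'h \<Rightarrow> real" where
  "ip_norm ip x = sqrt (re_part (ip x x))"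

definition orthonormal_family :: "('h \<Rightarrow> 'h \<Rightarrow> 'k::real_or_complex) \<Rightarrow> 'i set \<Rightarrow> ('i \<Rightarrow> 'h) \<Rightarrow> bool" where
  "orthonormal_family ip I e \<longleftrightarrow>
     (\<forall>i\<in>I. \<forall>j\<in>I. ip (e i) (e j) = (if i = j then 1 else 0))"

end

theory Submission
  imports Defs
begin

text \<open>
  Put \<open>m = (\<Sum>i\<in>F. (\<phi> i + \<Phi> i) / 2 \<cdot> e i)\<close> and \<open>d = (\<Sum>i\<in>F. (\<Phi> i - \<phi> i) / 2 \<cdot> e i)\<close>. The vectors in
  condition (i) are \<open>d - (x - m)\<close> and \<open>d + (x - m)\<close>, so the real part of their inner product is
  \<open>\<parallel>d\<parallel>\<^sup>2 - \<parallel>x - m\<parallel>\<^sup>2\<close>, which gives the equivalence with (ii). The estimates follow by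
  expanding \<open>\<parallel>x - (\<Sum>i\<in>F. a i \<cdot> e i)\<parallel>\<^sup>2\<close> for arbitrary coefficients \<open>a\<close> and completing the
  squares. Equality with constant \<open>1/4\<close> occurs in the plane for \<open>e = (1, 0)\<close>, \<open>x = (0, 1)\<close>,
  \<open>\<phi> = -1\<close> and \<open>\<Phi> = 1\<close>.
\<close>

section \<open>Scalars: conjugation and real part, computed through the complex numbers\<close>

lemma to_complex_0 [simp]: "to_complex 0 = 0"
  using to_complex_scaleR[of 0 0] by simp

lemma to_complex_minus: "to_complex (- x) = - to_complex x"
  using to_complex_scaleR[of "-1" x] by simp

lemma to_complex_diff: "to_complex (x - y) = to_complex x - to_complex y"
  using to_complex_add[of x "- y"] by (simp add: to_complex_minus)

text \<open>Injectivity of \<open>to_complex\<close> determines a conjugate by its image, so the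
  rules for \<open>scalar_cnj\<close> below reduce to those for \<open>cnj\<close>.\<close>

lemma scalar_cnj_eqI: "to_complex w = cnj (to_complex z) \<Longrightarrow> scalar_cnj z = w"
  using inj_to_complex by (metis injD to_complex_scalar_cnj)

lemma scalar_cnj_add: "scalar_cnj (x + y) = scalar_cnj x + scalar_cnj y"
  by (rule scalar_cnj_eqI) (simp add: to_complex_add to_complex_scalar_cnj)

lemma scalar_cnj_mult: "scalar_cnj (x * y) = scalar_cnj x * scalar_cnj y"
  by (rule scalar_cnj_eqI) (simp add: to_complex_mult to_complex_scalar_cnj)

lemma scalar_cnj_scalar_cnj [simp]: "scalar_cnj (scalar_cnj x) = x"
  by (rule scalar_cnj_eqI) (simp add: to_complex_scalar_cnj)

lemma scalar_cnj_0 [simp]: "scalar_cnj 0 = 0"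
  by (rule scalar_cnj_eqI) simp

lemma scalar_cnj_1 [simp]: "scalar_cnj 1 = 1"
  by (rule scalar_cnj_eqI) (simp add: to_complex_one)

lemma re_part_add: "re_part (x + y) = re_part x + re_part y"
  by (simp add: re_part_def to_complex_add)

lemma re_part_minus: "re_part (- x) = - re_part x"
  by (simp add: re_part_def to_complex_minus)

lemma re_part_0 [simp]: "re_part 0 = 0"
  by (simp add: re_part_def)

lemma re_part_1 [simp]: "re_part 1 = 1"
  by (simp add: re_part_def to_complex_one)

lemma re_part_scalar_cnj [simp]: "re_part (scalar_cnj x) = re_part x"
  by (simp add: re_part_def to_complex_scalar_cnj)

lemma re_part_mult_scalar_cnj: "re_part (x * scalar_cnj x) = (norm x)\<^sup>2"
  by (metis Re_complex_of_real complex_norm_square norm_to_complex re_part_def to_complex_mult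
      to_complex_scalar_cnj)

text \<open>Scalar counterpart of \<open>ip_norm_diff_square\<close>; it will absorb the cross term
  that a single vector of the family contributes.\<close>

lemma norm_diff_square:
  "(norm (x - y))\<^sup>2 = (norm x)\<^sup>2 - 2 * re_part (x * scalar_cnj y) + (norm y)\<^sup>2"
proof -
  have "(norm z)\<^sup>2 = (Re (to_complex z))\<^sup>2 + (Im (to_complex z))\<^sup>2" for z :: 'a
    by (metis cmod_power2 norm_to_complex)
  then show ?thesis
    by (simp add: to_complex_diff re_part_def to_complex_mult to_complex_scalar_cnj)
      (simp add: power2_eq_square algebra_simps)
qed

lemma orthonormal_family_subset:
  "orthonormal_family ip I e \<Longrightarrow> F \<subseteq> I \<Longrightarrow> orthonormal_family ip F e"
  unfolding orthonormal_family_def by blast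

section \<open>Orthonormal expansions in an inner product space\<close>

context inner_product_space
begin

lemma ip_zero_left [simp]: "ip 0 y = 0"
  using ip_scale_left[of 0 0 y] by simp

lemma ip_minus_left: "ip (- x) y = - ip x y"
  using ip_scale_left[of "-1" x y] by simp

lemma ip_diff_left: "ip (x - y) z = ip x z - ip y z"
  using ip_add_left[of x "- y" z] by (simp add: ip_minus_left)

lemma ip_scale_right: "ip x (scale a y) = scalar_cnj a * ip x y"
  by (metis ip_commute ip_scale_left scalar_cnj_mult)

lemma ip_sum_left: "ip (\<Sum>i\<in>F. f i) y = (\<Sum>i\<in>F. ip (f i) y)"
  by (induction F rule: infinite_finite_induct) (simp_all add: ip_add_left)

lemma re_ip_add_left: "re_part (ip (x + y) z) = re_part (ip x z) + re_part (ip y z)"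
  by (simp add: ip_add_left re_part_add)

lemma re_ip_minus_left: "re_part (ip (- x) z) = - re_part (ip x z)"
  by (simp add: ip_minus_left re_part_minus)

lemma re_ip_commute: "re_part (ip y x) = re_part (ip x y)"
  by (metis ip_commute re_part_scalar_cnj)

lemma re_ip_diff_left: "re_part (ip (x - y) z) = re_part (ip x z) - re_part (ip y z)"
  using re_ip_add_left[of x "- y" z] by (simp add: re_ip_minus_left)

lemma re_ip_add_right: "re_part (ip z (x + y)) = re_part (ip z x) + re_part (ip z y)"
  using re_ip_add_left[of x y z] by (simp add: re_ip_commute)

lemma re_ip_diff_right: "re_part (ip z (x - y)) = re_part (ip z x) - re_part (ip z y)"
  using re_ip_diff_left[of x y z] by (simp add: re_ip_commute)

lemma ip_norm_square: "(ip_norm ip x)\<^sup>2 = re_part (ip x x)"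
  by (simp add: ip_norm_def ip_nonneg)

lemma ip_norm_nonneg: "0 \<le> ip_norm ip x"
  by (simp add: ip_norm_def ip_nonneg)

lemma ip_norm_minus: "ip_norm ip (- x) = ip_norm ip x"
  using re_ip_minus_left[of x "- x"] re_ip_minus_left[of x x] re_ip_commute[of "- x" x]
  by (simp add: ip_norm_def)

text \<open>The two cross terms are conjugate to each other, so their real parts cancel. This turns
  condition (i) into a comparison of norms.\<close>

lemma re_ip_diff_add: "re_part (ip (x - y) (x + y)) = (ip_norm ip x)\<^sup>2 - (ip_norm ip y)\<^sup>2"
  using re_ip_commute[of x y]
  by (simp add: ip_norm_square re_ip_diff_left re_ip_add_right)

lemma ip_norm_diff_square:
  "(ip_norm ip (x - y))\<^sup>2 = (ip_norm ip x)\<^sup>2 - 2 * re_part (ip x y) + (ip_norm ip y)\<^sup>2"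
  using re_ip_commute[of x y]
  by (simp add: ip_norm_square re_ip_diff_left re_ip_diff_right)

text \<open>Induction on \<open>F\<close>, subtracting one component at a time. The coefficients
  stay arbitrary because both the values \<open>ip x (e i)\<close> and the midpoints are inserted
  later.\<close>

lemma ip_norm_diff_sum_orthonormal:
  assumes "orthonormal_family ip F e" "finite F"
  shows "(ip_norm ip (x - (\<Sum>i\<in>F. scale (a i) (e i))))\<^sup>2 =
    (ip_norm ip x)\<^sup>2 - (\<Sum>i\<in>F. (norm (ip x (e i)))\<^sup>2) + (\<Sum>i\<in>F. (norm (a i - ip x (e i)))\<^sup>2)"
  using assms(2,1)
proof (induction F)
  case empty
  then show ?case by simp
next
  case (insert j F)
  define y where "y = x - (\<Sum>i\<in>F. scale (a i) (e i))"
  have ortho: "ip (e i) (e j) = 0" if "i \<in> F" for i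
    using insert.prems insert.hyps that by (auto simp: orthonormal_family_def)
  have unit: "ip (e j) (e j) = 1"
    using insert.prems by (simp add: orthonormal_family_def)
  \<comment> \<open>Everything subtracted so far is orthogonal to \<open>e j\<close>, so the
    residual \<open>y\<close> keeps the coefficient of \<open>x\<close>.\<close>
  have coeff: "ip y (e j) = ip x (e j)"
    by (simp add: y_def ip_diff_left ip_sum_left ip_scale_left ortho)
  have step: "x - (scale (a j) (e j) + (\<Sum>i\<in>F. scale (a i) (e i))) = y - scale (a j) (e j)"
    by (simp add: y_def algebra_simps)
  have "orthonormal_family ip F e"
    using insert.prems by (simp add: orthonormal_family_def)
  from insert.IH[OF this] have y: "(ip_norm ip y)\<^sup>2 =
    (ip_norm ip x)\<^sup>2 - (\<Sum>i\<in>F. (norm (ip x (e i)))\<^sup>2) + (\<Sum>i\<in>F. (norm (a i - ip x (e i)))\<^sup>2)"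
    by (simp add: y_def)
  have "(ip_norm ip (scale (a j) (e j)))\<^sup>2 = (norm (a j))\<^sup>2"
    by (simp add: ip_norm_square ip_scale_left ip_scale_right unit re_part_mult_scalar_cnj
        mult.commute[of "scalar_cnj _"])
  moreover have "re_part (ip y (scale (a j) (e j))) = re_part (ip x (e j) * scalar_cnj (a j))"
    by (simp add: ip_scale_right coeff mult.commute)
  \<comment> \<open>The squared distance in the space and the scalar one between
    \<open>ip x (e j)\<close> and \<open>a j\<close> have the same cross term; eliminating it
    completes the square.\<close>
  ultimately have "(ip_norm ip (y - scale (a j) (e j)))\<^sup>2 =
      (ip_norm ip y)\<^sup>2 - (norm (ip x (e j)))\<^sup>2 + (norm (a j - ip x (e j)))\<^sup>2"
    using norm_diff_square[of "ip x (e j)" "a j"]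
    by (simp add: ip_norm_diff_square norm_minus_commute)
  then show ?case
    unfolding sum.insert[OF insert.hyps] step y by simp
qed

text \<open>The expansion at \<open>x = 0\<close>, where all coefficients \<open>ip x (e i)\<close>
  vanish.\<close>

lemma ip_norm_sum_orthonormal:
  assumes "orthonormal_family ip F e" "finite F"
  shows "(ip_norm ip (\<Sum>i\<in>F. scale (a i) (e i)))\<^sup>2 = (\<Sum>i\<in>F. (norm (a i))\<^sup>2)"
  using ip_norm_diff_sum_orthonormal[OF assms, of 0 a]
  by (simp add: ip_norm_minus) (simp add: ip_norm_def)

text \<open>Choosing \<open>a i = ip x (e i)\<close> makes the last sum of the expansion vanish, and
  a square is left.\<close>

lemma bessel_inequality:
  assumes "orthonormal_family ip F e" "finite F"
  shows "(\<Sum>i\<in>F. (norm (ip x (e i)))\<^sup>2) \<le> (ip_norm ip x)\<^sup>2"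
proof -
  have "0 \<le> (ip_norm ip (x - (\<Sum>i\<in>F. scale (ip x (e i)) (e i))))\<^sup>2" by simp
  then show ?thesis
    by (simp add: ip_norm_diff_sum_orthonormal[OF assms])
qed

lemma re_ip_sum_diff:
  assumes "orthonormal_family ip F e" "finite F"
  shows "re_part (ip ((\<Sum>i\<in>F. scale (\<Phi> i) (e i)) - x) (x - (\<Sum>i\<in>F. scale (\<phi> i) (e i)))) =
    1 / 4 * (\<Sum>i\<in>F. (norm (\<Phi> i - \<phi> i))\<^sup>2)
      - (ip_norm ip (x - (\<Sum>i\<in>F. scale ((\<phi> i + \<Phi> i) / 2) (e i))))\<^sup>2"
proof -
  define m where "m = (\<Sum>i\<in>F. scale ((\<phi> i + \<Phi> i) / 2) (e i))"
  define d where "d = (\<Sum>i\<in>F. scale ((\<Phi> i - \<phi> i) / 2) (e i))"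
  have "(\<phi> i + \<Phi> i) / 2 + (\<Phi> i - \<phi> i) / 2 = \<Phi> i" "(\<phi> i + \<Phi> i) / 2 - (\<Phi> i - \<phi> i) / 2 = \<phi> i" for i
    by (simp_all add: field_simps)
  then have \<Phi>: "(\<Sum>i\<in>F. scale (\<Phi> i) (e i)) = m + d" and \<phi>: "(\<Sum>i\<in>F. scale (\<phi> i) (e i)) = m - d"
    unfolding m_def d_def sum.distrib[symmetric] sum_subtractf[symmetric]
      scale_left_distrib[symmetric] scale_left_diff_distrib[symmetric] by simp_all
  have "(\<Sum>i\<in>F. scale (\<Phi> i) (e i)) - x = d - (x - m)" "x - (\<Sum>i\<in>F. scale (\<phi> i) (e i)) = d + (x - m)"
    unfolding \<Phi> \<phi> by (simp_all add: algebra_simps)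
  \<comment> \<open>The constant 1/4 arises here, as the square of the factor 1/2 in the
    half-differences.\<close>
  moreover have "(ip_norm ip d)\<^sup>2 = 1 / 4 * (\<Sum>i\<in>F. (norm (\<Phi> i - \<phi> i))\<^sup>2)"
    unfolding d_def ip_norm_sum_orthonormal[OF assms]
    by (simp add: norm_divide power_divide sum_divide_distrib)
  ultimately show ?thesis
    by (simp only: re_ip_diff_add flip: m_def)
qed

theorem gruess_bessel:
  fixes e :: "'i \<Rightarrow> 'h" and \<phi> \<Phi> :: "'i \<Rightarrow> 'k" and x :: 'h
  assumes "orthonormal_family ip F e" "finite F"
  defines "S \<equiv> \<Sum>i\<in>F. (norm (\<Phi> i - \<phi> i))\<^sup>2"
    and "y \<equiv> x - (\<Sum>i\<in>F. scale ((\<phi> i + \<Phi> i) / 2) (e i))"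
    and "r \<equiv> re_part (ip ((\<Sum>i\<in>F. scale (\<Phi> i) (e i)) - x) (x - (\<Sum>i\<in>F. scale (\<phi> i) (e i))))"
  shows "0 \<le> r \<longleftrightarrow> ip_norm ip y \<le> 1 / 2 * sqrt S"
    and "0 \<le> r \<Longrightarrow> (ip_norm ip x)\<^sup>2 - (\<Sum>i\<in>F. (norm (ip x (e i)))\<^sup>2)
      \<le> 1 / 4 * S - (\<Sum>i\<in>F. (norm ((\<phi> i + \<Phi> i) / 2 - ip x (e i)))\<^sup>2)"
proof -
  have r: "r = 1 / 4 * S - (ip_norm ip y)\<^sup>2"
    unfolding r_def S_def y_def by (rule re_ip_sum_diff[OF assms(1,2)])
  have "0 \<le> S"
    by (simp add: S_def sum_nonneg)
  then have "(1 / 2 * sqrt S)\<^sup>2 = 1 / 4 * S"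
    by (simp add: power_mult_distrib power2_eq_square)
  \<comment> \<open>Both sides of (ii) are nonnegative, so comparing their squares loses
    nothing.\<close>
  then have "0 \<le> r \<longleftrightarrow> (ip_norm ip y)\<^sup>2 \<le> (1 / 2 * sqrt S)\<^sup>2"
    unfolding r by linarith
  also have "\<dots> \<longleftrightarrow> ip_norm ip y \<le> 1 / 2 * sqrt S"
    using \<open>0 \<le> S\<close> by (intro power_mono_iff) (simp_all add: ip_norm_nonneg)
  finally show "0 \<le> r \<longleftrightarrow> ip_norm ip y \<le> 1 / 2 * sqrt S" .
  show "(ip_norm ip x)\<^sup>2 - (\<Sum>i\<in>F. (norm (ip x (e i)))\<^sup>2)
      \<le> 1 / 4 * S - (\<Sum>i\<in>F. (norm ((\<phi> i + \<Phi> i) / 2 - ip x (e i)))\<^sup>2)" if "0 \<le> r"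
    \<comment> \<open>With midpoint coefficients the expansion computes the norm of
      \<open>y\<close>, and \<open>0 \<le> r\<close> becomes the claim after rearranging.\<close>
    using that ip_norm_diff_sum_orthonormal[OF assms(1,2), of x "\<lambda>i. (\<phi> i + \<Phi> i) / 2"]
    by (simp add: r flip: y_def)
qed

end

section \<open>Sharpness: the extremal configuration in the plane\<close>

definition plane_scale :: "'k::real_or_complex \<Rightarrow> 'k \<times> 'k \<Rightarrow> 'k \<times> 'k" where
  "plane_scale a u = (a * fst u, a * snd u)"

text \<open>The standard inner product on pairs of scalars, written with \<open>scalar_cnj\<close>
  so that one example serves both fields.\<close>

definition plane_ip :: "'k::real_or_complex \<times> 'k \<Rightarrow> 'k \<times> 'k \<Rightarrow> 'k" where
  "plane_ip u v = fst u * scalar_cnj (fst v) + snd u * scalar_cnj (snd v)"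

lemma re_part_plane_ip_self: "re_part (plane_ip u u) = (norm (fst u))\<^sup>2 + (norm (snd u))\<^sup>2"
  by (simp add: plane_ip_def re_part_add re_part_mult_scalar_cnj)

lemma inner_product_space_plane: "inner_product_space plane_scale plane_ip"
proof unfold_locales
  fix u :: "'a \<times> 'a"
  assume "plane_ip u u = 0"
  then have "(norm (fst u))\<^sup>2 + (norm (snd u))\<^sup>2 = 0"
    by (simp flip: re_part_plane_ip_self)
  then show "u = 0"
    by (simp add: prod_eq_iff)
qed (simp_all add: re_part_plane_ip_self, simp_all add: plane_scale_def plane_ip_def algebra_simps
      scalar_cnj_add scalar_cnj_mult prod_eq_iff)

text \<open>The midpoint of -1 and 1 is 0 and \<open>x\<close> is orthogonal to \<open>e 0\<close>,
  so both subtracted sums vanish. The real part in (i) is exactly 0 because \<open>x\<close> and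
  \<open>e 0\<close> have equal norm.\<close>

lemma plane_extremal:
  defines "e \<equiv> (\<lambda>_::nat. (1::'k::real_or_complex, 0::'k))" and "x \<equiv> (0::'k, 1::'k)"
  shows "orthonormal_family plane_ip {0} e"
    and "0 \<le> re_part (plane_ip ((\<Sum>i\<in>{0}. plane_scale 1 (e i)) - x)
           (x - (\<Sum>i\<in>{0}. plane_scale (- 1) (e i))))"
    and "ip_norm plane_ip x = 1"
    and "plane_ip x (e i) = 0"
  by (simp_all add: e_def x_def orthonormal_family_def plane_ip_def plane_scale_def ip_norm_def)

text \<open>Types cannot be quantified inside a formula, so sharpness is stated on the fixed space
  \<open>'k \<times> 'k\<close> with indices in \<open>nat\<close>. A bound that fails there also
  fails over all spaces.\<close>

theorem theorem3:
  shows "(\<forall>(scale :: 'k::real_or_complex \<Rightarrow> 'h::ab_group_add \<Rightarrow> 'h) (ip :: 'h \<Rightarrow> 'h \<Rightarrow> 'k)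
            (I :: 'i set) (e :: 'i \<Rightarrow> 'h) F (\<phi> :: 'i \<Rightarrow> 'k) (\<Phi> :: 'i \<Rightarrow> 'k) x.
          inner_product_space scale ip \<longrightarrow> orthonormal_family ip I e \<longrightarrow> finite F \<longrightarrow> F \<subseteq> I \<longrightarrow>
          (let
             cond_i = 0 \<le> re_part (ip ((\<Sum>i\<in>F. scale (\<Phi> i) (e i)) - x)
                                     (x - (\<Sum>i\<in>F. scale (\<phi> i) (e i))));
             cond_ii = ip_norm ip (x - (\<Sum>i\<in>F. scale ((\<phi> i + \<Phi> i) / 2) (e i)))
                         \<le> 1 / 2 * sqrt (\<Sum>i\<in>F. (norm (\<Phi> i - \<phi> i))\<^sup>2)
           in
             (cond_i \<longleftrightarrow> cond_ii) \<and>
             (cond_i \<or> cond_ii \<longrightarrow>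
                0 \<le> (ip_norm ip x)\<^sup>2 - (\<Sum>i\<in>F. (norm (ip x (e i)))\<^sup>2) \<and>
                (ip_norm ip x)\<^sup>2 - (\<Sum>i\<in>F. (norm (ip x (e i)))\<^sup>2)
                  \<le> 1 / 4 * (\<Sum>i\<in>F. (norm (\<Phi> i - \<phi> i))\<^sup>2)
                     - (\<Sum>i\<in>F. (norm ((\<phi> i + \<Phi> i) / 2 - ip x (e i)))\<^sup>2) \<and>
                1 / 4 * (\<Sum>i\<in>F. (norm (\<Phi> i - \<phi> i))\<^sup>2)
                     - (\<Sum>i\<in>F. (norm ((\<phi> i + \<Phi> i) / 2 - ip x (e i)))\<^sup>2)
                  \<le> 1 / 4 * (\<Sum>i\<in>F. (norm (\<Phi> i - \<phi> i))\<^sup>2))))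
       \<and>
       (\<forall>c::real. c < 1 / 4 \<longrightarrow>
          \<not> (\<forall>(scale :: 'k \<Rightarrow> 'k \<times> 'k \<Rightarrow> 'k \<times> 'k) ip (I :: nat set) e F \<phi> \<Phi> x.
                inner_product_space scale ip \<longrightarrow> orthonormal_family ip I e \<longrightarrow>
                finite F \<longrightarrow> F \<subseteq> I \<longrightarrow>
                0 \<le> re_part (ip ((\<Sum>i\<in>F. scale (\<Phi> i) (e i)) - x)
                               (x - (\<Sum>i\<in>F. scale (\<phi> i) (e i)))) \<longrightarrow>
                (ip_norm ip x)\<^sup>2 - (\<Sum>i\<in>F. (norm (ip x (e i)))\<^sup>2)
                  \<le> c * (\<Sum>i\<in>F. (norm (\<Phi> i - \<phi> i))\<^sup>2)
                     - (\<Sum>i\<in>F. (norm ((\<phi> i + \<Phi> i) / 2 - ip x (e i)))\<^sup>2)) \<and>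
          \<not> (\<forall>(scale :: 'k \<Rightarrow> 'k \<times> 'k \<Rightarrow> 'k \<times> 'k) ip (I :: nat set) e F \<phi> \<Phi> x.
                inner_product_space scale ip \<longrightarrow> orthonormal_family ip I e \<longrightarrow>
                finite F \<longrightarrow> F \<subseteq> I \<longrightarrow>
                0 \<le> re_part (ip ((\<Sum>i\<in>F. scale (\<Phi> i) (e i)) - x)
                               (x - (\<Sum>i\<in>F. scale (\<phi> i) (e i)))) \<longrightarrow>
                (ip_norm ip x)\<^sup>2 - (\<Sum>i\<in>F. (norm (ip x (e i)))\<^sup>2)
                  \<le> c * (\<Sum>i\<in>F. (norm (\<Phi> i - \<phi> i))\<^sup>2)))"
proof (intro conjI allI impI notI, goal_cases)
  case (1 scale ip I e F \<phi> \<Phi> x)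
  interpret inner_product_space scale ip by (rule 1(1))
  have F: "orthonormal_family ip F e"
    using orthonormal_family_subset[OF 1(2,4)] .
  note gruess = gruess_bessel[OF F 1(3), where \<Phi> = \<Phi> and \<phi> = \<phi> and x = x]
  show ?case
    \<comment> \<open>Rewriting (ii) back to (i) leaves a single hypothesis; the last inequality
      only drops a sum of squares.\<close>
    unfolding Let_def gruess(1)[symmetric]
    using gruess(2) bessel_inequality[OF F 1(3), of x] by (auto simp: sum_nonneg)
next
  case (2 c)
  \<comment> \<open>Here \<open>I\<close> and \<open>F\<close> are both \<open>{0}\<close>. The left
    side is 1 and the squared difference of the scalars is 4, which forces
    \<open>1 \<le> c * 4\<close>.\<close>
  from 2(2)[rule_format, OF inner_product_space_plane plane_extremal(1) _ subset_refl plane_extremal(2)]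
  have "1 \<le> c * 4"
    by (simp add: plane_extremal)
  with 2(1) show False by simp
next
  case (3 c)
  from 3(2)[rule_format, OF inner_product_space_plane plane_extremal(1) _ subset_refl plane_extremal(2)]
  have "1 \<le> c * 4"
    by (simp add: plane_extremal)
  with 3(1) show False by simp
qed

end
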